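(* Let $G$ be a nontrivial finite abelian group. Then the following are equivalent: (1) $G$ is not cyclic. (2) $G$ contains a square of a cyclic group, i.e. $G$ has a subgroup isomorphic to $C_n\times C_n$ for some $n\ge2$. (3) The Radon transform $R$ is injective on $G$.
   Context: For $n\ge 2$ let $C_n$ be the cyclic group of order $n$, and let $\Gamma_n$ be the set of nontrivial homomorphisms $C_n\to G$. For $f:G\to\mathbb{C}$, $x\in G$ and $\gamma\in\Gamma_n$ put $R_nf(x,\gamma)=\sum_{t\in C_n}f(x\gamma(t))$. The Radon transform is $Rf=(R_nf)_{n\ge2}$; it is injective on $G$ if the only $f:G\to\mathbb{C}$ with $R_nf=0$ for all $n\ge2$ is $f=0$. *)

theory Defs
  imports Complex_Main "HOL-Algebra.Elementary_Groups"
begin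

text \<open>
  The cyclic group of order \<open>n\<close> is \<^term>\<open>integer_mod_group n\<close> (for \<open>n \<ge> 1\<close>).
  Functions on a group are HOL functions on the whole type of which only the values on
  the carrier matter; likewise \<^const>\<open>hom\<close> does not fix values outside the carrier.
\<close>

definition nontrivial_homs :: "nat \<Rightarrow> ('a, 'b) monoid_scheme \<Rightarrow> (int \<Rightarrow> 'a) set" where
  "nontrivial_homs n G =
     {\<gamma> \<in> hom (integer_mod_group n) G. \<exists>t \<in> carrier (integer_mod_group n). \<gamma> t \<noteq> \<one>\<^bsub>G\<^esub>}"

definition radon_transform ::
  "('a, 'b) monoid_scheme \<Rightarrow> nat \<Rightarrow> ('a \<Rightarrow> complex) \<Rightarrow> 'a \<Rightarrow> (int \<Rightarrow> 'a) \<Rightarrow> complex" where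
  "radon_transform G n f x \<gamma> = (\<Sum>t \<in> carrier (integer_mod_group n). f (x \<otimes>\<^bsub>G\<^esub> \<gamma> t))"

definition radon_injective :: "('a, 'b) monoid_scheme \<Rightarrow> bool" where
  "radon_injective G \<longleftrightarrow>
     (\<forall>f :: 'a \<Rightarrow> complex.
        (\<forall>n \<ge> 2. \<forall>x \<in> carrier G. \<forall>\<gamma> \<in> nontrivial_homs n G. radon_transform G n f x \<gamma> = 0)
        \<longrightarrow> (\<forall>x \<in> carrier G. f x = 0))"

definition contains_cyclic_square :: "('a, 'b) monoid_scheme \<Rightarrow> bool" where
  "contains_cyclic_square G \<longleftrightarrow>
     (\<exists>n \<ge> 2. \<exists>H. subgroup H G \<and>
        G\<lparr>carrier := H\<rparr> \<cong> integer_mod_group n \<times>\<times> integer_mod_group n)"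

end

theory Submission
  imports Defs "HOL-Algebra.Multiplicative_Group" "HOL-Computational_Algebra.Primes"
begin

text \<open>
  The equivalence is proved as a cycle: not cyclic, hence containing a square, hence injective,
  hence not cyclic.

  A subgroup isomorphic to \<open>C\<^sub>n \<times> C\<^sub>n\<close> is the same as a pair \<open>a, b\<close> of elements of order \<open>n\<close> with
  no relation between them beyond those forced by their orders
  (\<open>contains_cyclic_square_iff_independent_pair\<close>), and all arguments are carried out with such pairs.

  If \<open>G\<close> is not cyclic, take \<open>g\<close> whose order is the exponent of \<open>G\<close> and put \<open>H = \<langle>g\<rangle>\<close>, a proper
  subgroup. Some \<open>y\<close> outside \<open>H\<close> has a prime power \<open>y\<^sup>p\<close> inside \<open>H\<close>. Because \<open>ord g\<close> is
  the exponent, \<open>p\<close> divides \<open>ord g\<close> and \<open>y\<^sup>p\<close> is a \<open>p\<close>-th power in \<open>H\<close>; dividing \<open>y\<close> by such a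
  \<open>p\<close>-th root gives an element of order \<open>p\<close> outside \<open>H\<close>. Together with an element of order
  \<open>p\<close> of \<open>H\<close> it forms an independent pair.

  If \<open>a, b\<close> is an independent pair of order \<open>n\<close> and all transforms of \<open>f\<close> vanish, add up the
  transforms of \<open>f\<close> at \<open>x\<close> along the \<open>n\<close> lines \<open>t \<mapsto> (a b\<^sup>k)\<^sup>t\<close>. Exchanging the sums, the terms
  with a fixed \<open>t \<noteq> 0\<close> run along the line \<open>k \<mapsto> (b\<^sup>t)\<^sup>k\<close> through \<open>x a\<^sup>t\<close> and cancel, whereas \<open>t = 0\<close>
  contributes \<open>n f(x)\<close>. Hence \<open>f(x) = 0\<close>.

  If \<open>G\<close> is cyclic, a faithful character \<open>\<chi>\<close> exists. Along any nontrivial \<open>\<gamma>\<close> it restricts to a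
  nontrivial character of \<open>C\<^sub>n\<close>, whose values add up to zero, so \<open>\<chi>\<close> is a nonzero function in
  the kernel of the transform.
\<close>

section \<open>Powers and homomorphisms from cyclic groups\<close>

lemma (in group) int_pow_mod_exponent:
  assumes a: "a \<in> carrier G" and n: "a [^] int n = \<one>"
  shows "a [^] (k mod int n) = a [^] k"
proof -
  have "int (ord a) dvd int n"
    using n int_pow_eq_id[OF a] by blast
  then have "int (ord a) dvd k - k mod int n"
    using dvd_trans dvd_minus_mod by blast
  then show ?thesis
    using int_pow_eq[OF a] by blast
qed

lemma (in group) int_pow_hom_integer_mod_group:
  assumes a: "a \<in> carrier G" and n: "a [^] int n = \<one>"
  shows "(\<lambda>t. a [^] t) \<in> hom (integer_mod_group n) G"
  using a by (auto simp: hom_def int_pow_mod_exponent[OF a n] int_pow_mult)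

lemma (in group) hom_integer_mod_group_eq_int_pow:
  assumes h: "h \<in> hom (integer_mod_group n) G" and n: "n \<ge> 2"
  shows "h (k mod int n) = h 1 [^] k"
proof -
  have 1: "1 \<in> carrier (integer_mod_group n)"
    using n by simp
  have "h (1 [^]\<^bsub>integer_mod_group n\<^esub> k) = h 1 [^] k"
    by (rule hom_int_pow[OF h 1]) auto
  then show ?thesis
    by (simp add: int_pow_integer_mod_group)
qed

lemma (in group) mem_subgroup_if_coprime_powers:
  assumes H: "subgroup H G" and x: "x \<in> carrier G"
    and ij: "x [^] i \<in> H" "x [^] j \<in> H" and cop: "coprime i (j::int)"
  shows "x \<in> H"
proof -
  obtain u v where "u * i + v * j = 1"
    using cop bezout_int[of i j] by (auto simp: coprime_iff_gcd_eq_1)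
  then have "x = x [^] (i * u + j * v)"
    using x by (simp add: algebra_simps)
  also have "\<dots> = (x [^] i) [^] u \<otimes> (x [^] j) [^] v"
    using x by (simp add: int_pow_mult int_pow_pow)
  also have "\<dots> \<in> H"
    using H ij by (simp add: subgroup.m_closed subgroup_int_pow_closed)
  finally show ?thesis .
qed

section \<open>Squares of cyclic groups as independent pairs\<close>

text \<open>
  An isomorphism from \<open>C\<^sub>n \<times> C\<^sub>n\<close> is determined by the images \<open>a\<close>, \<open>b\<close> of the two standard
  generators. The biconditional on the right packs together that \<open>a\<close> and \<open>b\<close> have order \<open>n\<close>, which
  makes \<open>(i, j) \<mapsto> a\<^sup>i b\<^sup>j\<close> well defined modulo \<open>n\<close>, and that this map has trivial kernel.
\<close>
lemma (in comm_group) contains_cyclic_square_iff_independent_pair: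
  "contains_cyclic_square G \<longleftrightarrow>
     (\<exists>n \<ge> 2. \<exists>a \<in> carrier G. \<exists>b \<in> carrier G.
        \<forall>i j :: int. a [^] i \<otimes> b [^] j = \<one> \<longleftrightarrow> int n dvd i \<and> int n dvd j)"
proof
  assume "contains_cyclic_square G"
  then obtain n H where n: "n \<ge> 2" and H: "subgroup H G"
    and iso: "G\<lparr>carrier := H\<rparr> \<cong> integer_mod_group n \<times>\<times> integer_mod_group n"
    by (auto simp: contains_cyclic_square_def)
  let ?Z = "integer_mod_group n"
  have "?Z \<times>\<times> ?Z \<cong> G\<lparr>carrier := H\<rparr>"
    using iso group.iso_sym[OF subgroup_imp_group[OF H]] by blast
  then obtain h where h: "h \<in> iso (?Z \<times>\<times> ?Z) (G\<lparr>carrier := H\<rparr>)"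
    by (auto simp: is_iso_def)
  have hom: "h \<in> hom (?Z \<times>\<times> ?Z) G"
    using h subgroup.subset[OF H] by (auto simp: iso_def hom_def)
  have inj: "inj_on h (carrier ?Z \<times> carrier ?Z)"
    using h by (auto simp: iso_def bij_betw_def)
  have Z0: "0 \<in> carrier ?Z" and Z1: "1 \<in> carrier ?Z"
    using n by auto
  have Zmod: "i mod int n \<in> carrier ?Z" for i
    using n by (simp add: carrier_integer_mod_group)
  have mult: "h (s \<otimes>\<^bsub>?Z\<^esub> s', t \<otimes>\<^bsub>?Z\<^esub> t') = h (s, t) \<otimes> h (s', t')"
    if "s \<in> carrier ?Z" "s' \<in> carrier ?Z" "t \<in> carrier ?Z" "t' \<in> carrier ?Z" for s s' t t'
    using hom_mult[OF hom, of "(s,t)" "(s',t')"] that by simp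
  have cl: "h (s, t) \<in> carrier G" if "s \<in> carrier ?Z" "t \<in> carrier ?Z" for s t
    using hom_in_carrier[OF hom] that by simp
  have ha: "(\<lambda>s. h (s, 0)) \<in> hom ?Z G" and hb: "(\<lambda>t. h (0, t)) \<in> hom ?Z G"
    using mult[OF _ _ Z0 Z0] mult[OF Z0 Z0] cl Z0 by (auto simp: hom_def)
  let ?a = "h (1, 0)" and ?b = "h (0, 1)"
  have pow: "?a [^] i \<otimes> ?b [^] j = h (i mod int n, j mod int n)" for i j
    using hom_integer_mod_group_eq_int_pow[OF ha n, of i]
      hom_integer_mod_group_eq_int_pow[OF hb n, of j]
      mult[OF Zmod Z0 Z0 Zmod, of i j] by simp
  have "h (0, 0) = \<one>"
    using hom_one[OF hom] by (simp add: DirProd_group)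
  then have "?a [^] i \<otimes> ?b [^] j = \<one> \<longleftrightarrow> int n dvd i \<and> int n dvd j" for i j
    using inj_on_eq_iff[OF inj, of "(i mod int n, j mod int n)" "(0,0)"] Zmod Z0
    by (simp add: pow dvd_eq_mod_eq_0)
  then show "\<exists>n \<ge> 2. \<exists>a \<in> carrier G. \<exists>b \<in> carrier G.
        \<forall>i j :: int. a [^] i \<otimes> b [^] j = \<one> \<longleftrightarrow> int n dvd i \<and> int n dvd j"
    using n cl[OF Z1 Z0] cl[OF Z0 Z1] by blast
next
  assume "\<exists>n \<ge> 2. \<exists>a \<in> carrier G. \<exists>b \<in> carrier G.
        \<forall>i j :: int. a [^] i \<otimes> b [^] j = \<one> \<longleftrightarrow> int n dvd i \<and> int n dvd j"
  then obtain n a b where n: "n \<ge> 2" and a: "a \<in> carrier G" and b: "b \<in> carrier G"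
    and ind: "\<And>i j :: int. a [^] i \<otimes> b [^] j = \<one> \<longleftrightarrow> int n dvd i \<and> int n dvd j"
    by blast
  let ?Z = "integer_mod_group n"
  have an: "a [^] int n = \<one>" and bn: "b [^] int n = \<one>"
    using ind[of "int n" 0] ind[of 0 "int n"] a b by auto
  define h where "h = (\<lambda>(i::int, j::int). a [^] i \<otimes> b [^] j)"
  have hom: "h \<in> hom (?Z \<times>\<times> ?Z) G"
    using a b
    by (auto simp: hom_def h_def int_pow_mod_exponent[OF a an] int_pow_mod_exponent[OF b bn]
        int_pow_mult m_ac)
  interpret h: group_hom "?Z \<times>\<times> ?Z" G h
    using hom by (simp add: group_hom_def group_hom_axioms_def DirProd_group)
  have "inj_on h (carrier (?Z \<times>\<times> ?Z))"
  proof (unfold h.inj_on_one_iff, intro allI impI)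
    fix x assume "x \<in> carrier (?Z \<times>\<times> ?Z)" "h x = \<one>"
    then show "x = \<one>\<^bsub>?Z \<times>\<times> ?Z\<^esub>"
      using n by (auto simp: h_def ind carrier_integer_mod_group zdvd_not_zless
          dest: zdvd_imp_le split: prod.splits)
  qed
  then have "h \<in> iso (?Z \<times>\<times> ?Z) (G\<lparr>carrier := h ` carrier (?Z \<times>\<times> ?Z)\<rparr>)"
    using hom by (auto simp: iso_def bij_betw_def hom_def)
  then have "G\<lparr>carrier := h ` carrier (?Z \<times>\<times> ?Z)\<rparr> \<cong> ?Z \<times>\<times> ?Z"
    using group.iso_sym[of "?Z \<times>\<times> ?Z"] by (auto simp: is_iso_def DirProd_group)
  moreover have "subgroup (h ` carrier (?Z \<times>\<times> ?Z)) G"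
    by (rule h.img_is_subgroup)
  ultimately show "contains_cyclic_square G"
    using n unfolding contains_cyclic_square_def by blast
qed

section \<open>A group that is not cyclic contains a square\<close>

lemma (in comm_group) ord_mult_coprime:
  assumes x: "x \<in> carrier G" and y: "y \<in> carrier G" and cop: "coprime (ord x) (ord y)"
  shows "ord (x \<otimes> y) = ord x * ord y"
proof (rule dvd_antisym[OF abelian_ord_mul_divides[OF x y]])
  \<comment> \<open>Raising \<open>uv\<close> to a multiple of \<open>ord v\<close> kills \<open>v\<close> and leaves a condition on \<open>u\<close> alone.\<close>
  have key: "ord u dvd ord (u \<otimes> v)"
    if u: "u \<in> carrier G" and v: "v \<in> carrier G" and uv: "coprime (ord u) (ord v)" for u v
  proof -
    let ?N = "ord (u \<otimes> v) * ord v"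
    have "v [^] ?N = \<one>" "(u \<otimes> v) [^] ?N = \<one>"
      using u v by (simp_all add: pow_eq_id)
    then have "u [^] ?N = \<one>"
      using u v by (simp add: nat_pow_distrib)
    then show ?thesis
      using u uv by (simp add: pow_eq_id coprime_dvd_mult_left_iff)
  qed
  have "ord x dvd ord (x \<otimes> y)" "ord y dvd ord (x \<otimes> y)"
    using key[OF x y cop] key[OF y x] cop x y by (simp_all add: m_comm coprime_commute)
  then show "ord x * ord y dvd ord (x \<otimes> y)"
    using cop by (rule divides_mult)
qed

text \<open>
  An element \<open>g\<close> of maximal order works: if some prime \<open>p\<close> occurred to a higher power in \<open>ord x\<close>
  than in \<open>ord g\<close>, the product of the \<open>p\<close>-part of \<open>x\<close> and the prime-to-\<open>p\<close> part of \<open>g\<close> would have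
  larger order than \<open>g\<close>.
\<close>
lemma (in comm_group) exists_ord_is_exponent:
  assumes fin: "finite (carrier G)"
  shows "\<exists>g \<in> carrier G. \<forall>x \<in> carrier G. ord x dvd ord g"
proof -
  have "Max (ord ` carrier G) \<in> ord ` carrier G"
    using fin one_closed by (intro Max_in) auto
  then obtain g where g: "g \<in> carrier G" and g_eq: "ord g = Max (ord ` carrier G)"
    by auto
  have g_max: "ord x \<le> ord g" if "x \<in> carrier G" for x
    using fin that by (simp add: g_eq)
  have "ord x dvd ord g" if x: "x \<in> carrier G" for x
  proof (rule multiplicity_le_imp_dvd)
    show "ord x \<noteq> 0"
      using ord_ge_1[OF fin x] by simp
    fix p :: nat assume p: "prime p"
    show "multiplicity p (ord x) \<le> multiplicity p (ord g)"
    proof (rule ccontr)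
      assume less: "\<not> ?thesis"
      define e f where "e = multiplicity p (ord g)" and "f = multiplicity p (ord x)"
      have ef: "e < f" using less by (simp add: e_def f_def)
      obtain m where m: "ord g = p ^ e * m" "\<not> p dvd m"
        using multiplicity_decompose'[of "ord g" p] ord_ge_1[OF fin g] p
        unfolding e_def by (metis not_prime_unit not_one_le_zero)
      obtain k where k: "ord x = p ^ f * k" "\<not> p dvd k"
        using multiplicity_decompose'[of "ord x" p] ord_ge_1[OF fin x] p
        unfolding f_def by (metis not_prime_unit not_one_le_zero)
      have p0: "p > 0" and m0: "m > 0" and k0: "k > 0"
        using p m k by (auto simp: prime_gt_0_nat intro!: Nat.gr0I)
      have o1: "ord (g [^] (p ^ e)) = m"
        using ord_pow[OF g, of "p ^ e"] m p0 by simp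
      have o2: "ord (x [^] k) = p ^ f"
        using ord_pow[OF x, of k] k k0 by simp
      have "coprime m (p ^ f)"
        using p m(2) by (metis coprime_commute coprime_power_right_iff prime_imp_coprime)
      then have "ord (g [^] (p ^ e) \<otimes> x [^] k) = m * p ^ f"
        using ord_mult_coprime[of "g [^] (p ^ e)" "x [^] k"] g x by (simp add: o1 o2)
      moreover have "ord g < m * p ^ f"
        using m m0 power_strict_increasing[OF ef prime_gt_1_nat[OF p]] by simp
      ultimately show False
        using g_max[of "g [^] (p ^ e) \<otimes> x [^] k"] g x by simp
    qed
  qed
  then show ?thesis using g by blast
qed

text \<open>
  This replaces an element of prime order in a quotient by \<open>H\<close>, without requiring \<open>H\<close> to be normal:
  from the least exponent \<open>q\<close> with \<open>y\<^sup>q \<in> H\<close> split off one prime factor.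
\<close>
lemma (in group) exists_prime_power_into_subgroup:
  assumes fin: "finite (carrier G)" and H: "subgroup H G" and ne: "H \<noteq> carrier G"
  shows "\<exists>p y. prime (p::nat) \<and> y \<in> carrier G \<and> y \<notin> H \<and> y [^] p \<in> H"
proof -
  obtain y where y: "y \<in> carrier G" "y \<notin> H"
    using ne subgroup.subset[OF H] by blast
  define P where "P = (\<lambda>q::nat. q > 0 \<and> y [^] q \<in> H)"
  have "P (ord y)"
    using ord_ge_1[OF fin y(1)] y(1) subgroup.one_closed[OF H] by (simp add: P_def)
  then obtain q where q: "P q" and least: "\<And>r. P r \<Longrightarrow> q \<le> r"
    by (metis LeastI Least_le)
  have "q \<noteq> 1"
    using q y by (auto simp: P_def)
  then obtain p where p: "prime p" "p dvd q"
    using prime_factor_nat by blast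
  then obtain r where r: "q = r * p" by (metis dvd_def mult.commute)
  have "0 < r" "r < q"
    using q r prime_gt_1_nat[OF p(1)] by (auto simp: P_def)
  then have "y [^] r \<notin> H"
    using least[of r] by (auto simp: P_def)
  moreover have "(y [^] r) [^] p \<in> H"
    using q y r by (simp add: P_def nat_pow_pow)
  ultimately show ?thesis
    using p y by blast
qed

lemma (in comm_group) contains_cyclic_square_if_not_cyclic:
  assumes fin: "finite (carrier G)" and nc: "\<not> cyclic_group G"
  shows "contains_cyclic_square G"
proof -
  obtain g where g: "g \<in> carrier G" and expo: "\<And>x. x \<in> carrier G \<Longrightarrow> ord x dvd ord g"
    using exists_ord_is_exponent[OF fin] by blast
  define H where "H = range (\<lambda>k::int. g [^] k)"
  have H: "subgroup H G"
    unfolding H_def by (rule subgroup_of_powers[OF g])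
  have "H \<noteq> carrier G"
    using nc g by (auto simp: cyclic_group H_def)
  then obtain p y where p: "prime p" and y: "y \<in> carrier G" "y \<notin> H" "y [^] int p \<in> H"
    using exists_prime_power_into_subgroup[OF fin H] by (auto simp: int_pow_int)
  have expo_int: "y [^] int (ord g) = \<one>"
    using expo[OF y(1)] y(1) by (simp add: int_pow_eq_id)
  \<comment> \<open>Otherwise \<open>y\<^sup>p\<close> and \<open>y\<close> to the exponent of the group, both in \<open>H\<close>, would force \<open>y \<in> H\<close>.\<close>
  have "p dvd ord g"
  proof (rule ccontr)
    assume "\<not> p dvd ord g"
    then have "coprime (int p) (int (ord g))"
      using p prime_imp_coprime by auto
    then show False
      using mem_subgroup_if_coprime_powers[OF H y(1) y(3), of "int (ord g)"] y(2) expo_int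
        subgroup.one_closed[OF H] by simp
  qed
  then obtain r where r: "ord g = p * r" ..
  have r0: "r > 0"
    using ord_ge_1[OF fin g] r by (auto intro: Nat.gr0I)
  obtain k :: int where k: "y [^] int p = g [^] k"
    using y(3) unfolding H_def by blast
  \<comment> \<open>Comparing \<open>g\<^bsup>kr\<^esup> = y\<^bsup>pr\<^esup> = 1\<close> with \<open>ord g = pr\<close> shows that \<open>y\<^sup>p\<close> is a \<open>p\<close>-th power in \<open>H\<close>.\<close>
  have "g [^] (k * int r) = y [^] int (ord g)"
    using g y(1) r k by (metis int_pow_pow of_nat_mult)
  then have "int (p * r) dvd k * int r"
    using expo_int int_pow_eq_id[OF g] r by simp
  then have "int p dvd k"
    using r0 by simp
  then obtain l where l: "k = int p * l" ..
  \<comment> \<open>The independent pair of order \<open>p\<close>: \<open>w\<close> inside \<open>H\<close>, and \<open>z\<close> in the coset of \<open>y\<close>.\<close>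
  define z where "z = y \<otimes> g [^] (- l)"
  define w where "w = g [^] int r"
  have z: "z \<in> carrier G" and w: "w \<in> carrier G"
    using y g by (auto simp: z_def w_def)
  have zp: "z [^] int p = \<one>"
    using y(1) g by (simp add: z_def int_pow_distrib k int_pow_pow l mult.commute
        flip: int_pow_mult)
  have zH: "z \<notin> H"
  proof
    assume "z \<in> H"
    moreover have "g [^] l \<in> H" by (simp add: H_def)
    ultimately have "z \<otimes> g [^] l \<in> H"
      using H by (simp add: subgroup.m_closed)
    moreover have "z \<otimes> g [^] l = y"
      using y(1) g by (simp add: z_def m_assoc flip: int_pow_mult)
    ultimately show False using y(2) by simp
  qed
  have w_eq: "w [^] j = \<one> \<longleftrightarrow> int p dvd j" for j :: int
  proof -
    have "w [^] j = \<one> \<longleftrightarrow> int r * int p dvd int r * j"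
      using g by (simp add: w_def int_pow_pow int_pow_eq_id r mult.commute)
    then show ?thesis
      using r0 by simp
  qed
  have z_eq: "z [^] i = \<one>" if "int p dvd i" for i :: int
    using zp that z by (metis int_pow_eq_id dvd_trans)
  have "z [^] i \<otimes> w [^] j = \<one> \<longleftrightarrow> int p dvd i \<and> int p dvd j" for i j :: int
  proof
    assume eq: "z [^] i \<otimes> w [^] j = \<one>"
    \<comment> \<open>If not, \<open>z\<^sup>i \<in> H\<close> and \<open>z\<^sup>p = 1 \<in> H\<close> have coprime exponents and put \<open>z\<close> itself into \<open>H\<close>.\<close>
    have "int p dvd i"
    proof (rule ccontr)
      assume "\<not> int p dvd i"
      then have cop: "coprime (int p) i"
        using p by (simp add: prime_imp_coprime)
      have "z [^] i = inv (w [^] j)"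
        using eq z w by (simp add: inv_equality)
      also have "\<dots> \<in> H"
        using H by (simp add: subgroup.m_inv_closed subgroup_int_pow_closed w_def H_def)
      finally have "z \<in> H"
        using mem_subgroup_if_coprime_powers[OF H z _ _ cop] zp subgroup.one_closed[OF H] by simp
      with zH show False ..
    qed
    with eq z w show "int p dvd i \<and> int p dvd j"
      by (simp add: z_eq flip: w_eq)
  next
    assume "int p dvd i \<and> int p dvd j"
    then show "z [^] i \<otimes> w [^] j = \<one>"
      by (simp add: z_eq w_eq[THEN iffD2])
  qed
  then show ?thesis
    unfolding contains_cyclic_square_iff_independent_pair
    using z w prime_ge_2_nat[OF p] by blast
qed

section \<open>A square makes the transform injective\<close>

lemma (in group) radon_transform_int_pow_eq_0:
  assumes f: "\<forall>n \<ge> 2. \<forall>x \<in> carrier G. \<forall>\<gamma> \<in> nontrivial_homs n G. radon_transform G n f x \<gamma> = 0"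
    and n: "n \<ge> 2" and x: "x \<in> carrier G" and c: "c \<in> carrier G" "c \<noteq> \<one>" "c [^] int n = \<one>"
  shows "(\<Sum>t = 0..<int n. f (x \<otimes> c [^] t)) = 0"
proof -
  have "(\<lambda>t. c [^] t) \<in> nontrivial_homs n G"
    unfolding nontrivial_homs_def
    using int_pow_hom_integer_mod_group[OF c(1,3)] n c
    by (auto intro!: bexI[of _ 1])
  with f n x have "radon_transform G n f x (\<lambda>t. c [^] t) = 0"
    by blast
  then show ?thesis
    using n by (simp add: radon_transform_def carrier_integer_mod_group)
qed

text \<open>
  The values \<open>f(x a\<^sup>t b\<^bsup>kt\<^esup>)\<close> form an \<open>n \<times> n\<close> array indexed by \<open>k\<close> and \<open>t\<close>. For fixed \<open>k\<close> they
  are the terms of a transform with direction \<open>a b\<^sup>k \<noteq> 1\<close>, and for fixed \<open>t\<close> those of a transform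
  with direction \<open>b\<^sup>t\<close>, which is trivial only for \<open>t = 0\<close>.
\<close>
lemma (in comm_group) radon_injective_if_contains_cyclic_square:
  assumes "contains_cyclic_square G"
  shows "radon_injective G"
  unfolding radon_injective_def
proof (intro allI impI ballI)
  fix f :: "'a \<Rightarrow> complex" and x
  assume f: "\<forall>n \<ge> 2. \<forall>x \<in> carrier G. \<forall>\<gamma> \<in> nontrivial_homs n G. radon_transform G n f x \<gamma> = 0"
    and x: "x \<in> carrier G"
  obtain n a b where n: "n \<ge> 2" and a: "a \<in> carrier G" and b: "b \<in> carrier G"
    and ind: "\<And>i j :: int. a [^] i \<otimes> b [^] j = \<one> \<longleftrightarrow> int n dvd i \<and> int n dvd j"
    using assms contains_cyclic_square_iff_independent_pair by blast
  have b_eq: "b [^] j = \<one> \<longleftrightarrow> int n dvd j" for j :: int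
    using ind[of 0 j] b by simp
  let ?Z = "{0..<int n}"
  have row: "(\<Sum>t\<in>?Z. f (x \<otimes> (a \<otimes> b [^] k) [^] t)) = 0" for k :: int
  proof (rule radon_transform_int_pow_eq_0[OF f n x])
    show "a \<otimes> b [^] k \<noteq> \<one>"
      using ind[of 1 k] a n by auto
    show "(a \<otimes> b [^] k) [^] int n = \<one>"
      using ind[of "int n" "k * int n"] a b by (simp add: int_pow_distrib int_pow_pow)
  qed (use a b in simp)
  have column: "(\<Sum>k\<in>?Z. f (x \<otimes> (a \<otimes> b [^] k) [^] t)) = (if t = 0 then of_nat n * f x else 0)"
    if t: "t \<in> ?Z" for t
  proof (cases "t = 0")
    case True
    then show ?thesis using x a b by simp
  next
    case False
    have "(\<Sum>k\<in>?Z. f ((x \<otimes> a [^] t) \<otimes> (b [^] t) [^] k)) = 0"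
    proof (rule radon_transform_int_pow_eq_0[OF f n])
      show "b [^] t \<noteq> \<one>"
        using t False zdvd_imp_le[of "int n" t] by (auto simp: b_eq)
      show "(b [^] t) [^] int n = \<one>"
        using b by (simp add: int_pow_pow b_eq)
    qed (use x a b in auto)
    then show ?thesis
      using False x a b by (simp add: int_pow_distrib int_pow_pow m_assoc mult.commute)
  qed
  have "0 = (\<Sum>k\<in>?Z. \<Sum>t\<in>?Z. f (x \<otimes> (a \<otimes> b [^] k) [^] t))"
    by (simp add: row)
  also have "\<dots> = (\<Sum>t\<in>?Z. \<Sum>k\<in>?Z. f (x \<otimes> (a \<otimes> b [^] k) [^] t))"
    by (rule sum.swap)
  also have "\<dots> = of_nat n * f x"
    using n by (simp add: column)
  finally show "f x = 0"
    using n by simp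
qed

section \<open>The transform has a kernel on a cyclic group\<close>

lemma (in group) cyclic_group_faithful_character:
  assumes fin: "finite (carrier G)" and cyc: "cyclic_group G"
  shows "\<exists>\<chi> :: 'a \<Rightarrow> complex.
           (\<forall>x \<in> carrier G. \<forall>y \<in> carrier G. \<chi> (x \<otimes> y) = \<chi> x * \<chi> y) \<and>
           (\<forall>x \<in> carrier G. \<chi> x = 1 \<longleftrightarrow> x = \<one>)"
proof -
  obtain g where g: "g \<in> carrier G" and gen: "carrier G = range (\<lambda>k::int. g [^] k)"
    using cyc by (auto simp: cyclic_group)
  define N where "N = ord g"
  have N: "N > 0"
    using ord_ge_1[OF fin g] by (simp add: N_def)
  define e where "e = (\<lambda>k::int. cis (2 * pi * real_of_int k / real N))"
  have e_add: "e (i + j) = e i * e j" for i j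
    by (simp add: e_def cis_mult ring_distribs add_divide_distrib)
  have e_1: "e k = 1 \<longleftrightarrow> int N dvd k" for k
  proof
    assume "e k = 1"
    then have "cos (2 * pi * real_of_int k / real N) = 1"
      by (simp add: e_def complex_eq_iff)
    then obtain m :: int where "2 * pi * real_of_int k / real N = real_of_int m * (2 * pi)"
      by (auto simp: cos_one_2pi_int)
    then have "real_of_int k = real_of_int (m * int N)"
      using N by (simp add: field_simps)
    then have "k = m * int N"
      by (simp only: of_int_eq_iff)
    then show "int N dvd k" by simp
  next
    assume "int N dvd k"
    then obtain m where "k = int N * m" ..
    then have "2 * pi * real_of_int k / real N = 2 * pi * real_of_int m"
      using N by simp
    then show "e k = 1"
      unfolding e_def by (metis Ints_of_int cis_multiple_2pi)
  qed
  \<comment> \<open>A discrete logarithm; by \<open>e_1\<close> the value of \<open>e\<close> does not depend on which one is chosen.\<close>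
  define \<chi> where "\<chi> = (\<lambda>x. e (SOME k. x = g [^] k))"
  have \<chi>: "\<chi> (g [^] k) = e k" for k
  proof -
    define l where "l = (SOME l. g [^] k = g [^] (l::int))"
    have "g [^] k = g [^] l"
      unfolding l_def by (rule someI_ex) blast
    then have "int N dvd l - k"
      using int_pow_eq[OF g] by (simp add: N_def)
    then have "e (l - k) = 1"
      by (simp add: e_1)
    then have "e (k + (l - k)) = e k"
      by (simp only: e_add mult_1_right)
    then show ?thesis
      by (simp add: \<chi>_def flip: l_def)
  qed
  have "\<chi> (x \<otimes> y) = \<chi> x * \<chi> y" if xy: "x \<in> carrier G" "y \<in> carrier G" for x y
  proof -
    obtain i j :: int where "x = g [^] i" "y = g [^] j"
      using xy unfolding gen by blast
    then show ?thesis
      using g by (simp add: \<chi> e_add flip: int_pow_mult)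
  qed
  moreover have "\<chi> x = 1 \<longleftrightarrow> x = \<one>" if x: "x \<in> carrier G" for x
  proof -
    obtain i :: int where "x = g [^] i"
      using x unfolding gen by blast
    then show ?thesis
      using g by (simp add: \<chi> e_1 int_pow_eq_id N_def)
  qed
  ultimately show ?thesis by blast
qed

lemma (in group) sum_nontrivial_character_eq_0:
  fixes \<psi> :: "'a \<Rightarrow> complex"
  assumes mult: "\<And>x y. x \<in> carrier G \<Longrightarrow> y \<in> carrier G \<Longrightarrow> \<psi> (x \<otimes> y) = \<psi> x * \<psi> y"
    and s: "s \<in> carrier G" "\<psi> s \<noteq> 1"
  shows "(\<Sum>t\<in>carrier G. \<psi> t) = 0"
proof -
  \<comment> \<open>Translation by \<open>s\<close> permutes the terms and multiplies the sum by \<open>\<psi> s \<noteq> 1\<close>.\<close>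
  have "bij_betw (\<lambda>t. s \<otimes> t) (carrier G) (carrier G)"
    using s by (simp add: bij_betw_def inj_on_cmult surj_const_mult)
  then have "(\<Sum>t\<in>carrier G. \<psi> t) = (\<Sum>t\<in>carrier G. \<psi> (s \<otimes> t))"
    by (rule sum.reindex_bij_betw[symmetric])
  also have "\<dots> = \<psi> s * (\<Sum>t\<in>carrier G. \<psi> t)"
    using s by (simp add: mult sum_distrib_left)
  finally show ?thesis
    using s(2) by simp
qed

lemma (in group) not_radon_injective_if_cyclic:
  assumes fin: "finite (carrier G)" and cyc: "cyclic_group G"
  shows "\<not> radon_injective G"
proof
  assume inj: "radon_injective G"
  obtain \<chi> :: "'a \<Rightarrow> complex"
    where mult: "\<And>x y. x \<in> carrier G \<Longrightarrow> y \<in> carrier G \<Longrightarrow> \<chi> (x \<otimes> y) = \<chi> x * \<chi> y"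
      and faithful: "\<And>x. x \<in> carrier G \<Longrightarrow> \<chi> x = 1 \<longleftrightarrow> x = \<one>"
    using cyclic_group_faithful_character[OF fin cyc] by blast
  have "radon_transform G n \<chi> x \<gamma> = 0"
    if x: "x \<in> carrier G" and \<gamma>: "\<gamma> \<in> nontrivial_homs n G" for n x \<gamma>
  proof -
    let ?Z = "integer_mod_group n"
    have hom: "\<gamma> \<in> hom ?Z G"
      using \<gamma> by (simp add: nontrivial_homs_def)
    obtain s where s: "s \<in> carrier ?Z" "\<gamma> s \<noteq> \<one>"
      using \<gamma> by (auto simp: nontrivial_homs_def)
    have cl: "\<gamma> t \<in> carrier G" if "t \<in> carrier ?Z" for t
      using hom_in_carrier[OF hom that] .
    have "(\<Sum>t\<in>carrier ?Z. \<chi> (\<gamma> t)) = 0"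
    proof (rule group.sum_nontrivial_character_eq_0[where s = s])
      show "\<chi> (\<gamma> (u \<otimes>\<^bsub>?Z\<^esub> v)) = \<chi> (\<gamma> u) * \<chi> (\<gamma> v)"
        if "u \<in> carrier ?Z" "v \<in> carrier ?Z" for u v
        using that hom_mult[OF hom that] by (simp add: mult cl del: mult_integer_mod_group)
    qed (use s faithful cl in auto)
    then have "(\<Sum>t\<in>carrier ?Z. \<chi> x * \<chi> (\<gamma> t)) = 0"
      by (simp flip: sum_distrib_left)
    then show ?thesis
      using x by (simp add: radon_transform_def mult cl)
  qed
  then have "\<chi> \<one> = 0"
    using inj unfolding radon_injective_def by blast
  with faithful[OF one_closed] show False by simp
qed

theorem theorem3p5:
  fixes G :: "('a, 'b) monoid_scheme"
  assumes "comm_group G" and "finite (carrier G)" and "\<not> trivial_group G"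
  shows "(\<not> cyclic_group G \<longleftrightarrow> contains_cyclic_square G) \<and>
         (contains_cyclic_square G \<longleftrightarrow> radon_injective G)"
proof -
  interpret comm_group G by fact
  show ?thesis
    using contains_cyclic_square_if_not_cyclic radon_injective_if_contains_cyclic_square
      not_radon_injective_if_cyclic \<open>finite (carrier G)\<close>
    by blast
qed

end
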